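(* For any (possibly partial) Boolean function $f:\mathcal{D}\subseteq\{0,1\}^n\to\{0,1\}$: 1. $\lambda^{\mathsf{cert}}(f)=\sqrt{\mathsf{s}(f)}\ge\sqrt{\lambda(f)}$; 2. $\mathrm{rdeg}^{\mathsf{cert}}(f)=\mathrm{rdeg}(f)$.
   Context: For $z\in\mathcal{D}$, $f^{\mathsf{cert}}_z$ is the partial function with domain $\{z\}\cup\{y\in\mathcal{D}: f(y)\ne f(z)\}$, with $f^{\mathsf{cert}}_z(z)=1$ and $f^{\mathsf{cert}}_z(y)=0$ whenever $f(y)\neq f(z)$. For a complexity measure $\mathsf{M}$ of (possibly partial) Boolean functions, $\mathsf{M}^{\mathsf{cert}}(f):=\max_{z\in\mathcal{D}}\mathsf{M}(f^{\mathsf{cert}}_z)$. Sensitivity: $\mathsf{s}(f)=\max_{x\in\mathcal{D}}\left|\{i\in[n]: x^i\in\mathcal{D},\ f(x^i)\ne f(x)\}\right|$, where $x^i$ is $x$ with the $i$-th bit flipped. Spectral sensitivity: $\lambda(f)=\|M_f\|$ (spectral norm), where $M_f$ is the $\mathcal{D}\times\mathcal{D}$ matrix with $M_f(x,y)=1$ if $f(x)\neq f(y)$ and $x,y$ are at Hamming distance $1$, and $M_f(x,y)=0$ otherwise. Rational degree: $\mathrm{rdeg}(f)$ is the minimum of $\max\{\deg(P),\deg(Q)\}$ over real polynomials $P,Q$ with $Q(x)\neq 0$ and $P(x)/Q(x)=f(x)$ for all $x\in\mathcal{D}$. *)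

theory Defs
  imports "HOL-Analysis.L2_Norm" "HOL-Library.Poly_Mapping"
begin

text \<open>A partial Boolean function \<open>f : D \<subseteq> {0,1}\<^sup>n \<rightarrow> {0,1}\<close> is a partial map on Boolean lists with
  \<open>dom f \<subseteq> cube n\<close>; its domain \<open>D\<close> is \<open>dom f\<close>. Bit positions are numbered \<open>0, \<dots>, n - 1\<close>.\<close>

definition cube :: "nat \<Rightarrow> bool list set" where
  "cube n = {x. length x = n}"

definition flip_bit :: "bool list \<Rightarrow> nat \<Rightarrow> bool list" where
  "flip_bit x i = x[i := \<not> x ! i]"

definition hamming_dist :: "nat \<Rightarrow> bool list \<Rightarrow> bool list \<Rightarrow> nat" where
  "hamming_dist n x y = card {i. i < n \<and> x ! i \<noteq> y ! i}"

definition f_cert :: "(bool list \<rightharpoonup> bool) \<Rightarrow> bool list \<Rightarrow> (bool list \<rightharpoonup> bool)" where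
  "f_cert f z = (\<lambda>y. if y = z then Some True
                     else if y \<in> dom f \<and> f y \<noteq> f z then Some False
                     else None)"

definition cert_measure ::
    "((bool list \<rightharpoonup> bool) \<Rightarrow> 'a::linorder) \<Rightarrow> (bool list \<rightharpoonup> bool) \<Rightarrow> 'a" where
  "cert_measure M f = Max ((\<lambda>z. M (f_cert f z)) ` dom f)"

definition sensitivity :: "nat \<Rightarrow> (bool list \<rightharpoonup> bool) \<Rightarrow> nat" where
  "sensitivity n f =
     Max ((\<lambda>x. card {i. i < n \<and> flip_bit x i \<in> dom f \<and> f (flip_bit x i) \<noteq> f x}) ` dom f)"

text \<open>The spectral norm of a real matrix with rows and columns indexed by a finite set \<open>D\<close>: its
  operator norm for the Euclidean norm on \<open>\<real>\<^sup>D\<close>. Vectors are functions of which only the values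
  on \<open>D\<close> matter.\<close>

definition spectral_norm :: "'a set \<Rightarrow> ('a \<Rightarrow> 'a \<Rightarrow> real) \<Rightarrow> real" where
  "spectral_norm D A =
     (SUP v\<in>{v. L2_set v D \<le> 1}. L2_set (\<lambda>x. \<Sum>y\<in>D. A x y * v y) D)"

definition sens_matrix ::
    "nat \<Rightarrow> (bool list \<rightharpoonup> bool) \<Rightarrow> bool list \<Rightarrow> bool list \<Rightarrow> real" where
  "sens_matrix n f x y = (if f x \<noteq> f y \<and> hamming_dist n x y = 1 then 1 else 0)"

definition spectral_sensitivity :: "nat \<Rightarrow> (bool list \<rightharpoonup> bool) \<Rightarrow> real" where
  "spectral_sensitivity n f = spectral_norm (dom f) (sens_matrix n f)"

text \<open>Real multivariate polynomials are finitely supported maps from monomials to coefficients,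
  a monomial being a finitely supported map from variable indices to exponents.\<close>

type_synonym real_mpoly = "(nat \<Rightarrow>\<^sub>0 nat) \<Rightarrow>\<^sub>0 real"

definition mpolys :: "nat \<Rightarrow> real_mpoly set" where
  "mpolys n = {P. \<forall>m\<in>Poly_Mapping.keys P. Poly_Mapping.keys m \<subseteq> {..<n}}"

definition monom_degree :: "(nat \<Rightarrow>\<^sub>0 nat) \<Rightarrow> nat" where
  "monom_degree m = (\<Sum>i\<in>Poly_Mapping.keys m. Poly_Mapping.lookup m i)"

text \<open>The total degree; the zero polynomial gets degree 0.\<close>

definition mpoly_degree :: "real_mpoly \<Rightarrow> nat" where
  "mpoly_degree P = (if P = 0 then 0 else Max (monom_degree ` Poly_Mapping.keys P))"

definition mpoly_eval :: "real_mpoly \<Rightarrow> (nat \<Rightarrow> real) \<Rightarrow> real" where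
  "mpoly_eval P a = (\<Sum>m\<in>Poly_Mapping.keys P. Poly_Mapping.lookup P m * (\<Prod>i\<in>Poly_Mapping.keys m. a i ^ Poly_Mapping.lookup m i))"

definition bits :: "bool list \<Rightarrow> nat \<Rightarrow> real" where
  "bits x i = of_bool (x ! i)"

definition rationally_represents ::
    "real_mpoly \<Rightarrow> real_mpoly \<Rightarrow> (bool list \<rightharpoonup> bool) \<Rightarrow> bool" where
  "rationally_represents P Q f \<longleftrightarrow>
     (\<forall>x\<in>dom f. mpoly_eval Q (bits x) \<noteq> 0 \<and>
        mpoly_eval P (bits x) / mpoly_eval Q (bits x) = of_bool (the (f x)))"

definition rdeg :: "nat \<Rightarrow> (bool list \<rightharpoonup> bool) \<Rightarrow> nat" where
  "rdeg n f = (LEAST d. \<exists>P\<in>mpolys n. \<exists>Q\<in>mpolys n.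
     rationally_represents P Q f \<and> d = max (mpoly_degree P) (mpoly_degree Q))"

end

theory Submission
  imports Defs "HOL-Analysis.Convex"
begin

text \<open>The sensitivity graph of \<open>f_cert f z\<close> is a star centred at \<open>z\<close> whose leaves are the sensitive
  neighbours of \<open>z\<close>, and a star with \<open>k\<close> leaves has spectral norm \<open>\<surd>k\<close>; on the other hand the
  norm of the sensitivity graph of \<open>f\<close> is at most its maximum degree. Both upper bounds are
  instances of the weighted Schur test.

  For the rational degree, \<open>rdeg f \<le> d\<close> holds iff every \<open>z \<in> dom f\<close> has a polynomial of degree at
  most \<open>d\<close> that does not vanish at \<open>z\<close> but vanishes wherever \<open>f\<close> differs from \<open>f z\<close>, and for fixed
  \<open>z\<close> this is equivalent to \<open>rdeg (f_cert f z) \<le> d\<close>. Given such polynomials, generic linear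
  combinations \<open>P\<close> (over \<open>f z = 1\<close>) and \<open>R\<close> (over \<open>f z = 0\<close>) are nonzero on the respective fibres, so
  \<open>P / (P + R)\<close> represents \<open>f\<close>; no squaring is needed, hence no loss in the degree.\<close>

section \<open>Spectral norm\<close>

text \<open>Cauchy-Schwarz with weights: one factor carries \<open>A x y * p y\<close>, so the row
  bound applies at \<open>x\<close>; summing over \<open>x\<close> and using symmetry lets it apply
  again at \<open>y\<close>. The weight \<open>p\<close> imitates a Perron eigenvector with
  eigenvalue \<open>c\<close>.\<close>

lemma weighted_schur_test:
  fixes A :: "'a \<Rightarrow> 'a \<Rightarrow> real" and p v :: "'a \<Rightarrow> real"
  assumes "finite D" and c: "0 \<le> c"
    and nonneg: "\<And>x y. x \<in> D \<Longrightarrow> y \<in> D \<Longrightarrow> 0 \<le> A x y"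
    and sym: "\<And>x y. x \<in> D \<Longrightarrow> y \<in> D \<Longrightarrow> A x y = A y x"
    and pos: "\<And>x. x \<in> D \<Longrightarrow> 0 < p x"
    and row: "\<And>x. x \<in> D \<Longrightarrow> (\<Sum>y\<in>D. A x y * p y) \<le> c * p x"
  shows "L2_set (\<lambda>x. \<Sum>y\<in>D. A x y * v y) D \<le> c * L2_set v D"
proof -
  have "(\<Sum>x\<in>D. (\<Sum>y\<in>D. A x y * v y)\<^sup>2) \<le> (\<Sum>x\<in>D. c * p x * (\<Sum>y\<in>D. A x y * (v y)\<^sup>2 / p y))"
  proof (rule sum_mono)
    fix x assume x: "x \<in> D"
    have "(\<Sum>y\<in>D. A x y * v y) = (\<Sum>y\<in>D. sqrt (A x y * p y) * (sqrt (A x y / p y) * v y))"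
    proof (rule sum.cong)
      fix y assume y: "y \<in> D"
      have "sqrt (A x y * p y) * sqrt (A x y / p y) = A x y"
        using nonneg[OF x y] pos[OF y] by (simp flip: real_sqrt_mult)
      then show "A x y * v y = sqrt (A x y * p y) * (sqrt (A x y / p y) * v y)"
        by (metis mult.assoc)
    qed simp
    then have "(\<Sum>y\<in>D. A x y * v y)\<^sup>2
        \<le> (\<Sum>y\<in>D. (sqrt (A x y * p y))\<^sup>2) * (\<Sum>y\<in>D. (sqrt (A x y / p y) * v y)\<^sup>2)"
      using Cauchy_Schwarz_ineq_sum by metis
    also have "\<dots> = (\<Sum>y\<in>D. A x y * p y) * (\<Sum>y\<in>D. A x y * (v y)\<^sup>2 / p y)"
      using nonneg[OF x] pos
      by (intro arg_cong2[where f = "(*)"] sum.cong)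
         (auto simp: power_mult_distrib less_imp_le)
    also have "\<dots> \<le> c * p x * (\<Sum>y\<in>D. A x y * (v y)\<^sup>2 / p y)"
      using row[OF x] nonneg[OF x] pos
      by (intro mult_right_mono sum_nonneg) (auto simp: less_imp_le)
    finally show "(\<Sum>y\<in>D. A x y * v y)\<^sup>2 \<le> c * p x * (\<Sum>y\<in>D. A x y * (v y)\<^sup>2 / p y)" .
  qed
  \<comment> \<open>Replacing \<open>A x y\<close> by \<open>A y x\<close> turns the inner sum, once
    the order of summation is swapped, into the row sum of \<open>y\<close>.\<close>
  also have "\<dots> = (\<Sum>x\<in>D. \<Sum>y\<in>D. c * ((v y)\<^sup>2 / p y) * (A y x * p x))"
    unfolding sum_distrib_left by (intro sum.cong) (auto simp: sym)
  also have "\<dots> = (\<Sum>y\<in>D. c * ((v y)\<^sup>2 / p y) * (\<Sum>x\<in>D. A y x * p x))"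
    unfolding sum_distrib_left by (rule sum.swap)
  also have "\<dots> \<le> (\<Sum>y\<in>D. c * ((v y)\<^sup>2 / p y) * (c * p y))"
    using row pos c by (intro sum_mono mult_left_mono) (auto simp: less_imp_le)
  also have "\<dots> = (\<Sum>y\<in>D. c\<^sup>2 * (v y)\<^sup>2)"
    using pos by (intro sum.cong) (auto simp: power2_eq_square less_imp_neq[THEN not_sym])
  also have "\<dots> = (c * L2_set v D)\<^sup>2"
    by (simp add: L2_set_def power_mult_distrib sum_nonneg sum_distrib_left)
  finally show ?thesis
    using c unfolding L2_set_def[of "\<lambda>x. \<Sum>y\<in>D. A x y * v y"]
    by (intro real_le_lsqrt) (auto simp: sum_nonneg)
qed

lemma spectral_norm_le:
  assumes "\<And>v. L2_set (\<lambda>x. \<Sum>y\<in>D. A x y * v y) D \<le> c * L2_set v D" and "0 \<le> c"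
  shows "spectral_norm D A \<le> c"
  unfolding spectral_norm_def
proof (rule cSUP_least)
  have "L2_set (\<lambda>_. 0 :: real) D \<le> 1"
    by (simp add: L2_set_def)
  then show "{v. L2_set v D \<le> 1} \<noteq> {}"
    by blast
next
  fix v assume "v \<in> {v. L2_set v D \<le> 1}"
  with assms(2) have "c * L2_set v D \<le> c"
    by (simp add: mult_left_le)
  with assms(1) show "L2_set (\<lambda>x. \<Sum>y\<in>D. A x y * v y) D \<le> c"
    by (rule order_trans)
qed

text \<open>The constant \<open>c\<close> itself is irrelevant to the conclusion: it only shows that
  the set under the real supremum is bounded above.\<close>

lemma le_spectral_norm:
  assumes "\<And>v. L2_set (\<lambda>x. \<Sum>y\<in>D. A x y * v y) D \<le> c * L2_set v D" and "0 \<le> c"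
    and "L2_set w D \<le> 1"
  shows "L2_set (\<lambda>x. \<Sum>y\<in>D. A x y * w y) D \<le> spectral_norm D A"
  unfolding spectral_norm_def
proof (rule cSUP_upper)
  have "L2_set (\<lambda>x. \<Sum>y\<in>D. A x y * v y) D \<le> c" if "L2_set v D \<le> 1" for v
    using assms(1)[of v] mult_left_le[OF that assms(2)] by linarith
  then show "bdd_above ((\<lambda>v. L2_set (\<lambda>x. \<Sum>y\<in>D. A x y * v y) D) ` {v. L2_set v D \<le> 1})"
    by (intro bdd_aboveI2) blast
qed (use assms(3) in simp)

text \<open>Points outside \<open>S\<close> other than \<open>z\<close> are isolated. The upper
  bound is the Schur test with the Perron eigenvector of the star; the lower bound comes from the
  unit vector at the centre, whose image is the indicator of \<open>S\<close>.\<close>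

lemma spectral_norm_star:
  fixes A :: "'a \<Rightarrow> 'a \<Rightarrow> real"
  assumes fin: "finite D" and z: "z \<in> D" and S: "S \<subseteq> D" "z \<notin> S"
    and A: "\<And>x y. x \<in> D \<Longrightarrow> y \<in> D \<Longrightarrow> A x y = of_bool (x = z \<and> y \<in> S \<or> y = z \<and> x \<in> S)"
  shows "spectral_norm D A = sqrt (card S)"
proof -
  \<comment> \<open>For an empty \<open>S\<close> the centre would get weight 0, but the Schur test
    needs positive weights; hence the value 1 there.\<close>
  define p where "p x = (if x = z \<and> S \<noteq> {} then sqrt (card S) else 1)" for x
  have finS: "finite S"
    using S(1) fin by (rule finite_subset)
  have Az: "(\<Sum>y\<in>D. A z y * g y) = sum g S" for g
  proof -
    have "(\<Sum>y\<in>D. A z y * g y) = (\<Sum>y\<in>D. if y \<in> S then g y else 0)"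
      using z S A by (intro sum.cong) auto
    also have "\<dots> = sum g S"
      using S(1) fin by (simp add: sum.inter_restrict[symmetric] Int_absorb1)
    finally show ?thesis .
  qed
  have Ax: "(\<Sum>y\<in>D. A x y * g y) = (if x \<in> S then g z else 0)" if "x \<in> D" "x \<noteq> z" for x g
  proof -
    have "(\<Sum>y\<in>D. A x y * g y) = (\<Sum>y\<in>D. if y = z then (if x \<in> S then g z else 0) else 0)"
      using z S A that by (intro sum.cong) auto
    also have "\<dots> = (if x \<in> S then g z else 0)"
      using z fin by simp
    finally show ?thesis .
  qed
  have bound: "L2_set (\<lambda>x. \<Sum>y\<in>D. A x y * v y) D \<le> sqrt (card S) * L2_set v D" for v
  proof (rule weighted_schur_test[where p = p])
    fix x assume x: "x \<in> D"
    show "0 < p x"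
      using finS by (auto simp: p_def card_gt_0_iff)
    show "(\<Sum>y\<in>D. A x y * p y) \<le> sqrt (card S) * p x"
    proof (cases "x = z")
      case True
      have "sum p S = card S"
        using S(2) by (subst sum.cong[of S S p "\<lambda>_. 1"]) (auto simp: p_def)
      then show ?thesis
        by (auto simp: True Az p_def)
    next
      case False
      then show ?thesis
        by (auto simp: Ax[OF x] p_def)
    qed
  qed (use fin A in auto)
  show ?thesis
  proof (rule antisym)
    show "spectral_norm D A \<le> sqrt (card S)"
      by (rule spectral_norm_le[OF bound]) simp
    let ?w = "\<lambda>x. of_bool (x = z) :: real"
    have "L2_set ?w D \<le> 1"
      using fin z by (simp add: L2_set_def of_bool_def if_distrib[of "\<lambda>t. t\<^sup>2"] sum.If_cases)
    then have "L2_set (\<lambda>x. \<Sum>y\<in>D. A x y * ?w y) D \<le> spectral_norm D A"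
      by (rule le_spectral_norm[OF bound, rotated]) simp
    also have "L2_set (\<lambda>x. \<Sum>y\<in>D. A x y * ?w y) D = L2_set (\<lambda>x. of_bool (x \<in> S)) D"
    proof (rule L2_set_cong)
      fix x assume "x \<in> D"
      then show "(\<Sum>y\<in>D. A x y * ?w y) = of_bool (x \<in> S)"
        using S(2) Az[of ?w] Ax[of x ?w] by (cases "x = z") (auto intro!: sum.neutral)
    qed simp
    also have "\<dots> = sqrt (card S)"
      using fin S(1)
      by (simp add: L2_set_def of_bool_def if_distrib[of "\<lambda>t. t\<^sup>2"] sum.If_cases Int_absorb1
          cong: if_cong)
    finally show "sqrt (card S) \<le> spectral_norm D A" .
  qed
qed

section \<open>Sensitivity\<close>

text \<open>Phrased with Hamming distance to match \<open>sens_matrix\<close>; the link to the bit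
  flips in \<open>sensitivity\<close> is \<open>card_sensitive_neighbours\<close>.\<close>

definition sensitive_neighbours :: "nat \<Rightarrow> (bool list \<rightharpoonup> bool) \<Rightarrow> bool list \<Rightarrow> bool list set" where
  "sensitive_neighbours n f x = {y \<in> dom f. f x \<noteq> f y \<and> hamming_dist n x y = 1}"

lemma finite_cube: "finite (cube n)"
proof -
  have "cube n = {xs. set xs \<subseteq> UNIV \<and> length xs = n}"
    by (auto simp: cube_def)
  then show ?thesis
    using finite_lists_length_eq[of "UNIV :: bool set" n] by simp
qed

lemma hamming_dist_commute: "hamming_dist n x y = hamming_dist n y x"
  unfolding hamming_dist_def by (intro arg_cong[where f = card]) auto

lemma hamming_dist_eq_1_iff:
  assumes "x \<in> cube n" "y \<in> cube n"
  shows "hamming_dist n x y = 1 \<longleftrightarrow> (\<exists>i<n. y = flip_bit x i)"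
proof
  assume "hamming_dist n x y = 1"
  then obtain i where S: "{i. i < n \<and> x ! i \<noteq> y ! i} = {i}"
    unfolding hamming_dist_def by (rule card_1_singletonE)
  then have i: "i < n" "x ! i \<noteq> y ! i"
    by blast+
  have other: "x ! j = y ! j" if "j < n" "j \<noteq> i" for j
    using that S by blast
  have "y = flip_bit x i"
  proof (rule nth_equalityI)
    show "length y = length (flip_bit x i)"
      using assms by (simp add: flip_bit_def cube_def)
    show "y ! j = flip_bit x i ! j" if "j < length y" for j
      using that assms i other[of j]
      by (cases "j = i") (simp_all add: flip_bit_def cube_def)
  qed
  with \<open>i < n\<close> show "\<exists>i<n. y = flip_bit x i"
    by blast
next
  assume "\<exists>i<n. y = flip_bit x i"
  then obtain i where "i < n" "y = flip_bit x i"
    by blast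
  then have "{j. j < n \<and> x ! j \<noteq> y ! j} = {i}"
    using assms by (auto simp: flip_bit_def cube_def nth_list_update)
  then show "hamming_dist n x y = 1"
    by (simp add: hamming_dist_def)
qed

lemma card_sensitive_neighbours:
  assumes "dom f \<subseteq> cube n" "x \<in> dom f"
  shows "card {i. i < n \<and> flip_bit x i \<in> dom f \<and> f (flip_bit x i) \<noteq> f x}
    = card (sensitive_neighbours n f x)"
proof (rule bij_betw_same_card)
  have x: "x \<in> cube n"
    using assms by blast
  \<comment> \<open>Bit \<open>i\<close> tells the two flips apart: flipping at \<open>i\<close>
    changes it, flipping at another position does not.\<close>
  have "inj_on (flip_bit x) {..<n}"
  proof (rule inj_onI)
    fix i j assume ij: "i \<in> {..<n}" "j \<in> {..<n}" "flip_bit x i = flip_bit x j"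
    have "flip_bit x i ! i \<noteq> x ! i"
      using ij(1) x by (simp add: flip_bit_def cube_def)
    moreover have "flip_bit x j ! i = x ! i" if "i \<noteq> j"
      using that by (simp add: flip_bit_def)
    ultimately show "i = j"
      unfolding ij(3) by (rule contrapos_np)
  qed
  then have "inj_on (flip_bit x) {i. i < n \<and> flip_bit x i \<in> dom f \<and> f (flip_bit x i) \<noteq> f x}"
    by (rule inj_on_subset) auto
  moreover have "flip_bit x ` {i. i < n \<and> flip_bit x i \<in> dom f \<and> f (flip_bit x i) \<noteq> f x}
      = sensitive_neighbours n f x"
  proof -
    have iff: "y \<in> sensitive_neighbours n f x \<longleftrightarrow> y \<in> dom f \<and> f y \<noteq> f x \<and> (\<exists>i<n. y = flip_bit x i)"
      for y
    proof (cases "y \<in> dom f")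
      case True
      then have "y \<in> cube n"
        using assms(1) by blast
      from hamming_dist_eq_1_iff[OF x this] show ?thesis
        unfolding sensitive_neighbours_def mem_Collect_eq by metis
    qed (simp add: sensitive_neighbours_def)
    show ?thesis
      by (rule set_eqI, unfold iff image_iff) blast
  qed
  ultimately show "bij_betw (flip_bit x) {i. i < n \<and> flip_bit x i \<in> dom f \<and> f (flip_bit x i) \<noteq> f x}
      (sensitive_neighbours n f x)"
    by (simp add: bij_betw_def)
qed

lemma sensitivity_eq_Max_card:
  assumes "dom f \<subseteq> cube n"
  shows "sensitivity n f = Max ((\<lambda>x. card (sensitive_neighbours n f x)) ` dom f)"
  unfolding sensitivity_def
  using card_sensitive_neighbours[OF assms] by (simp cong: image_cong_simp)

lemma sum_sens_matrix:
  assumes "finite (dom f)"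
  shows "(\<Sum>y\<in>dom f. sens_matrix n f x y) = card (sensitive_neighbours n f x)"
  using assms by (simp add: sens_matrix_def sensitive_neighbours_def sum.If_cases Int_def)

text \<open>With constant weight 1 the Schur test bounds the norm by the largest row sum, which is
  the maximum degree of the sensitivity graph.\<close>

lemma spectral_sensitivity_le_sensitivity:
  assumes "dom f \<subseteq> cube n"
  shows "spectral_sensitivity n f \<le> sensitivity n f"
  unfolding spectral_sensitivity_def
proof (intro spectral_norm_le weighted_schur_test[where p = "\<lambda>_. 1"])
  show fin: "finite (dom f)"
    using assms finite_cube by (rule finite_subset)
  fix x assume "x \<in> dom f"
  then have "card (sensitive_neighbours n f x) \<le> sensitivity n f"
    unfolding sensitivity_eq_Max_card[OF assms] using fin by (intro Max_ge) auto
  then show "(\<Sum>y\<in>dom f. sens_matrix n f x y * 1) \<le> real (sensitivity n f) * 1"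
    using sum_sens_matrix[OF fin, of n x] by simp
qed (auto simp: sens_matrix_def hamming_dist_commute)

section \<open>Sensitivity graphs of certificate functions\<close>

lemma dom_f_cert: "dom (f_cert f z) = insert z {y \<in> dom f. f y \<noteq> f z}"
  by (auto simp: f_cert_def split: if_splits)

lemma spectral_sensitivity_f_cert:
  assumes "dom f \<subseteq> cube n" and "z \<in> dom f"
  shows "spectral_sensitivity n (f_cert f z) = sqrt (card (sensitive_neighbours n f z))"
  unfolding spectral_sensitivity_def
proof (rule spectral_norm_star[where z = z])
  have "finite (dom f)"
    using assms(1) finite_cube by (rule finite_subset)
  then show "finite (dom (f_cert f z))"
    by (simp add: dom_f_cert)
  show "sens_matrix n (f_cert f z) x y
      = of_bool (x = z \<and> y \<in> sensitive_neighbours n f z \<or> y = z \<and> x \<in> sensitive_neighbours n f z)"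
    if "x \<in> dom (f_cert f z)" "y \<in> dom (f_cert f z)" for x y
  proof -
    \<comment> \<open>Only \<open>z\<close> has value \<open>True\<close> under
      \<open>f_cert f z\<close>, so entries vanish unless exactly one index is \<open>z\<close>: the
      two middle cases carry the star, the other two give 0.\<close>
    consider "x = z" "y = z" | "x = z" "y \<in> dom f" "f y \<noteq> f z" | "y = z" "x \<in> dom f" "f x \<noteq> f z"
      | "x \<noteq> z" "y \<noteq> z" "x \<in> dom f" "f x \<noteq> f z" "y \<in> dom f" "f y \<noteq> f z"
      using \<open>x \<in> _\<close> \<open>y \<in> _\<close> unfolding dom_f_cert by blast
    then show ?thesis
    proof cases
      case 2
      then have "y \<noteq> z"
        by blast
      with 2 show ?thesis
        by (simp add: sens_matrix_def sensitive_neighbours_def f_cert_def eq_commute[of "f z"])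
    next
      case 3
      then have "x \<noteq> z"
        by blast
      with 3 show ?thesis
        by (simp add: sens_matrix_def sensitive_neighbours_def f_cert_def eq_commute[of "f z"]
            hamming_dist_commute[of n x z])
    qed (simp_all add: sens_matrix_def sensitive_neighbours_def f_cert_def)
  qed
qed (auto simp: dom_f_cert sensitive_neighbours_def)

lemma cert_spectral_sensitivity:
  assumes "dom f \<subseteq> cube n" and "dom f \<noteq> {}"
  shows "cert_measure (spectral_sensitivity n) f = sqrt (sensitivity n f)"
proof -
  have fin: "finite (dom f)"
    using assms(1) finite_cube by (rule finite_subset)
  \<comment> \<open>Monotonicity lets the square root commute with the maximum over the finite
    nonempty domain.\<close>
  have "mono (\<lambda>k. sqrt (real k))"
    by (intro monoI) simp
  then have "sqrt (sensitivity n f)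
      = Max ((\<lambda>k. sqrt (real k)) ` (\<lambda>x. card (sensitive_neighbours n f x)) ` dom f)"
    unfolding sensitivity_eq_Max_card[OF assms(1)]
    using fin assms(2) by (intro mono_Max_commute) auto
  also have "\<dots> = cert_measure (spectral_sensitivity n) f"
    unfolding cert_measure_def image_image
    using spectral_sensitivity_f_cert[OF assms(1)] by (simp cong: image_cong_simp)
  finally show ?thesis ..
qed

section \<open>Polynomials\<close>

definition mpolys_le :: "nat \<Rightarrow> nat \<Rightarrow> real_mpoly set" where
  "mpolys_le n d = {P \<in> mpolys n. mpoly_degree P \<le> d}"

text \<open>A condition on each monomial separately makes closure under linear combinations a matter
  of key containment. The zero polynomial has no keys, in accordance with its degree 0.\<close>

lemma mpolys_le_iff:
  "P \<in> mpolys_le n d \<longleftrightarrow>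
     (\<forall>m\<in>Poly_Mapping.keys P. Poly_Mapping.keys m \<subseteq> {..<n} \<and> monom_degree m \<le> d)"
proof -
  have "mpoly_degree P \<le> d \<longleftrightarrow> (\<forall>m\<in>Poly_Mapping.keys P. monom_degree m \<le> d)"
  proof (cases "P = 0")
    case False
    then have "Poly_Mapping.keys P \<noteq> {}"
      by (metis poly_mapping_eqI empty_iff in_keys_iff lookup_zero)
    with False show ?thesis
      by (simp add: mpoly_degree_def)
  qed (simp add: mpoly_degree_def)
  then show ?thesis
    by (auto simp: mpolys_le_def mpolys_def)
qed

lemma mpolys_le_add: "P \<in> mpolys_le n d \<Longrightarrow> Q \<in> mpolys_le n d \<Longrightarrow> P + Q \<in> mpolys_le n d"
  unfolding mpolys_le_iff using keys_add[of P Q] by blast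

definition smult :: "real \<Rightarrow> real_mpoly \<Rightarrow> real_mpoly" where
  "smult c = Poly_Mapping.map ((*) c)"

lemma lookup_smult: "Poly_Mapping.lookup (smult c P) m = c * Poly_Mapping.lookup P m"
  by (simp add: smult_def Poly_Mapping.map.rep_eq when_def)

lemma keys_smult: "Poly_Mapping.keys (smult c P) \<subseteq> Poly_Mapping.keys P"
  by (auto simp: in_keys_iff lookup_smult)

lemma mpolys_le_smult: "P \<in> mpolys_le n d \<Longrightarrow> smult c P \<in> mpolys_le n d"
  unfolding mpolys_le_iff using keys_smult[of c P] by blast

text \<open>Cancellation can shrink the keys of a sum, so evaluations are compared over a common
  finite set of monomials.\<close>

lemma mpoly_eval_superset:
  assumes "finite K" "Poly_Mapping.keys P \<subseteq> K"
  shows "mpoly_eval P a = (\<Sum>m\<in>K. Poly_Mapping.lookup P m *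
    (\<Prod>i\<in>Poly_Mapping.keys m. a i ^ Poly_Mapping.lookup m i))"
  unfolding mpoly_eval_def using assms
  by (intro sum.mono_neutral_left) (auto simp: in_keys_iff)

lemma mpoly_eval_add: "mpoly_eval (P + Q) a = mpoly_eval P a + mpoly_eval Q a"
proof -
  let ?K = "Poly_Mapping.keys P \<union> Poly_Mapping.keys Q"
  show ?thesis
    using keys_add[of P Q]
    by (simp add: mpoly_eval_superset[of ?K] lookup_add distrib_right sum.distrib)
qed

lemma mpoly_eval_smult: "mpoly_eval (smult c P) a = c * mpoly_eval P a"
  by (simp add: mpoly_eval_superset[of "Poly_Mapping.keys P"] keys_smult lookup_smult
      sum_distrib_left mult.assoc)

lemma mpoly_eval_0 [simp]: "mpoly_eval 0 a = 0"
  by (simp add: mpoly_eval_def)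

lemma mpolys_le_0 [simp]: "0 \<in> mpolys_le n d"
  by (simp add: mpolys_le_iff)

lemma mpolys_le_sum: "(\<And>w. w \<in> A \<Longrightarrow> P w \<in> mpolys_le n d) \<Longrightarrow> (\<Sum>w\<in>A. P w) \<in> mpolys_le n d"
  by (induction A rule: infinite_finite_induct) (auto intro: mpolys_le_add)

lemma mpoly_eval_sum: "mpoly_eval (\<Sum>w\<in>A. P w) a = (\<Sum>w\<in>A. mpoly_eval (P w) a)"
  by (induction A rule: infinite_finite_induct) (auto simp: mpoly_eval_add)

lemma mpoly_eval_single:
  "mpoly_eval (Poly_Mapping.single m c) a
     = c * (\<Prod>i\<in>Poly_Mapping.keys m. a i ^ Poly_Mapping.lookup m i)"
  by (simp add: mpoly_eval_def)

section \<open>Interpolation on the Boolean cube\<close>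

lemma exists_monomial:
  assumes "S \<subseteq> {..<n}"
  obtains P where "P \<in> mpolys_le n n" "\<And>a. mpoly_eval P a = (\<Prod>i\<in>S. a i)"
proof -
  \<comment> \<open>The exponent is 1 on \<open>S\<close> and 0 elsewhere; finiteness of
    \<open>S\<close> makes this a legitimate finitely supported map.\<close>
  define m :: "nat \<Rightarrow>\<^sub>0 nat" where "m = Abs_poly_mapping (\<lambda>i. of_bool (i \<in> S))"
  have "finite S"
    using assms finite_subset by blast
  then have lookup: "Poly_Mapping.lookup m i = of_bool (i \<in> S)" for i
    by (simp add: m_def)
  then have keys: "Poly_Mapping.keys m = S"
    by (auto simp: in_keys_iff)
  have "card S \<le> n"
    using assms by (metis card_lessThan card_mono finite_lessThan)
  then have "Poly_Mapping.single m 1 \<in> mpolys_le n n"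
    using assms by (simp add: mpolys_le_iff monom_degree_def keys lookup)
  moreover have "mpoly_eval (Poly_Mapping.single m 1) a = (\<Prod>i\<in>S. a i)" for a
    by (simp add: mpoly_eval_single keys lookup)
  ultimately show thesis
    by (rule that)
qed

text \<open>By downward induction on the support: the monomial of the support of \<open>z\<close> is the indicator of
  the up-set of \<open>z\<close>, from which the indicators of all points strictly above \<open>z\<close> are subtracted.\<close>

lemma exists_indicator_mpoly:
  assumes "z \<in> cube n"
  shows "\<exists>P\<in>mpolys_le n n. \<forall>x\<in>cube n. mpoly_eval P (bits x) = of_bool (x = z)"
  using assms
proof (induction "card {i. i < n \<and> \<not> z ! i}" arbitrary: z rule: less_induct)
  case less
  define up where "up = {w \<in> cube n. \<forall>i<n. z ! i \<longrightarrow> w ! i}"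
  have fin: "finite up"
    unfolding up_def using finite_cube by simp
  have z: "z \<in> up"
    using less.prems by (simp add: up_def)
  have "\<exists>P\<in>mpolys_le n n. \<forall>x\<in>cube n. mpoly_eval P (bits x) = of_bool (x = w)"
    if "w \<in> up - {z}" for w
  proof (rule less.hyps)
    show w: "w \<in> cube n"
      using that by (simp add: up_def)
    \<comment> \<open>Since \<open>w\<close> has all the ones of \<open>z\<close>, a difference can
      only occur at a zero of \<open>z\<close>, so \<open>w\<close> has strictly fewer
      zeros.\<close>
    have "\<exists>i<n. w ! i \<noteq> z ! i"
      using that w less.prems by (auto simp: cube_def list_eq_iff_nth_eq)
    then have "{i. i < n \<and> \<not> w ! i} \<subset> {i. i < n \<and> \<not> z ! i}"
      using that by (auto simp: up_def)
    then show "card {i. i < n \<and> \<not> w ! i} < card {i. i < n \<and> \<not> z ! i}"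
      by (intro psubset_card_mono) auto
  qed
  then obtain I where I: "\<And>w. w \<in> up - {z} \<Longrightarrow> I w \<in> mpolys_le n n"
    "\<And>w x. w \<in> up - {z} \<Longrightarrow> x \<in> cube n \<Longrightarrow> mpoly_eval (I w) (bits x) = of_bool (x = w)"
    by metis
  obtain M where M: "M \<in> mpolys_le n n" "\<And>a. mpoly_eval M a = (\<Prod>i | i < n \<and> z ! i. a i)"
    using exists_monomial[of "{i. i < n \<and> z ! i}" n] by blast
  have eval_M: "mpoly_eval M (bits x) = of_bool (x \<in> up)" if "x \<in> cube n" for x
  proof (cases "x \<in> up")
    case True
    then show ?thesis
      by (auto simp: M(2) up_def bits_def intro: prod.neutral)
  next
    case False
    then obtain i where "i < n" "z ! i" "\<not> x ! i"
      using \<open>x \<in> cube n\<close> by (auto simp: up_def)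
    then show ?thesis
      using False by (auto simp: M(2) bits_def)
  qed
  let ?P = "M + smult (- 1) (\<Sum>w\<in>up - {z}. I w)"
  have "?P \<in> mpolys_le n n"
    using I(1) M(1) by (intro mpolys_le_add mpolys_le_smult mpolys_le_sum)
  moreover have "mpoly_eval ?P (bits x) = of_bool (x = z)" if "x \<in> cube n" for x
  proof -
    have "(\<Sum>w\<in>up - {z}. mpoly_eval (I w) (bits x)) = (\<Sum>w\<in>up - {z}. if x = w then 1 else 0)"
      using I(2) that by (intro sum.cong) auto
    also have "\<dots> = of_bool (x \<in> up - {z})"
      using fin by simp
    finally show ?thesis
      using z by (auto simp: mpoly_eval_add mpoly_eval_smult mpoly_eval_sum eval_M[OF that])
  qed
  ultimately show ?case
    by blast
qed

section \<open>Rational degree\<close>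

text \<open>All but finitely many coefficients combine two elements of \<open>V\<close> without creating new common
  zeros.\<close>

lemma exists_common_nonvanishing:
  fixes ev :: "'p \<Rightarrow> 'x \<Rightarrow> real"
  assumes "finite A" and ex: "\<And>z. z \<in> A \<Longrightarrow> \<exists>P\<in>V. ev P z \<noteq> 0"
    and "V \<noteq> {}"
    and comb: "\<And>P Q c. P \<in> V \<Longrightarrow> Q \<in> V \<Longrightarrow> \<exists>R\<in>V. \<forall>x. ev R x = ev P x + c * ev Q x"
  shows "\<exists>P\<in>V. \<forall>z\<in>A. ev P z \<noteq> 0"
  using assms(1) ex
proof (induction A)
  case empty
  then show ?case
    using \<open>V \<noteq> {}\<close> by blast
next
  case (insert z A)
  obtain P where P: "P \<in> V" "\<forall>w\<in>A. ev P w \<noteq> 0"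
    using insert by blast
  obtain Q where Q: "Q \<in> V" "ev Q z \<noteq> 0"
    using insert.prems by blast
  \<comment> \<open>The excluded values are the roots of \<open>ev P w + c * ev Q w\<close>. Where
    \<open>ev Q w\<close> is 0, division by zero yields 0, which merely excludes one harmless
    value.\<close>
  obtain c where c: "c \<notin> (\<lambda>w. - ev P w / ev Q w) ` insert z A"
    using insert.hyps ex_new_if_finite[OF infinite_UNIV_char_0, of "(\<lambda>w. - ev P w / ev Q w) ` insert z A"]
    by blast
  obtain R where R: "R \<in> V" "\<forall>x. ev R x = ev P x + c * ev Q x"
    using comb[OF P(1) Q(1)] by blast
  have "ev P w + c * ev Q w \<noteq> 0" if w: "w \<in> insert z A" for w
  proof (cases "ev Q w = 0")
    case True
    then have "w \<in> A"
      using w Q(2) by auto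
    then show ?thesis
      using True P(2) by simp
  next
    case False
    have "c \<noteq> - ev P w / ev Q w"
      using c w by blast
    with False show ?thesis
      by (simp add: field_simps add_eq_0_iff)
  qed
  then show ?case
    using R by (intro bexI[of _ R]) simp_all
qed

text \<open>The pointwise criterion through which both rational degrees are compared. At
  \<open>z\<close> it sees only the points where \<open>f\<close> differs from \<open>f z\<close>,
  and these are the same for \<open>f_cert f z\<close>.\<close>

definition has_isolating_mpoly :: "nat \<Rightarrow> nat \<Rightarrow> (bool list \<rightharpoonup> bool) \<Rightarrow> bool list \<Rightarrow> bool" where
  "has_isolating_mpoly n d f z \<longleftrightarrow>
     (\<exists>P\<in>mpolys_le n d. mpoly_eval P (bits z) \<noteq> 0 \<and>
        (\<forall>y\<in>dom f. f y \<noteq> f z \<longrightarrow> mpoly_eval P (bits y) = 0))"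

lemma has_isolating_mpoly_n:
  assumes "dom f \<subseteq> cube n" "z \<in> dom f"
  shows "has_isolating_mpoly n n f z"
proof -
  have "z \<in> cube n"
    using assms by blast
  from exists_indicator_mpoly[OF this] obtain P where "P \<in> mpolys_le n n"
    "\<And>x. x \<in> cube n \<Longrightarrow> mpoly_eval P (bits x) = of_bool (x = z)"
    by blast
  moreover have "y \<in> cube n" if "y \<in> dom f" for y
    using assms(1) that by blast
  ultimately show ?thesis
    unfolding has_isolating_mpoly_def using \<open>z \<in> cube n\<close>
    by (intro bexI[of _ P] conjI ballI impI) auto
qed

lemma rationally_represents_if_isolating:
  assumes fin: "finite (dom f)"
    and iso: "\<And>z. z \<in> dom f \<Longrightarrow> has_isolating_mpoly n d f z"
  shows "\<exists>P\<in>mpolys_le n d. \<exists>Q\<in>mpolys_le n d. rationally_represents P Q f"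
proof -
  have "\<exists>P\<in>mpolys_le n d. \<forall>x\<in>dom f. mpoly_eval P (bits x) \<noteq> 0 \<longleftrightarrow> f x = Some b" for b
  proof -
    \<comment> \<open>\<open>V\<close> is a linear space, so the polynomials isolating single points
      of the fibre over \<open>b\<close> can be merged into one that is nonzero on the whole
      fibre.\<close>
    define V where "V = {P \<in> mpolys_le n d. \<forall>y\<in>dom f. f y \<noteq> Some b \<longrightarrow> mpoly_eval P (bits y) = 0}"
    have "\<exists>P\<in>V. \<forall>z\<in>{z. f z = Some b}. mpoly_eval P (bits z) \<noteq> 0"
    proof (rule exists_common_nonvanishing)
      show "finite {z. f z = Some b}"
        using fin by (rule rev_finite_subset) auto
      show "V \<noteq> {}"
        unfolding V_def using mpolys_le_0 mpoly_eval_0 by blast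
      show "\<exists>P\<in>V. mpoly_eval P (bits z) \<noteq> 0" if "z \<in> {z. f z = Some b}" for z
        using iso[of z] that unfolding V_def has_isolating_mpoly_def by auto
      show "\<exists>R\<in>V. \<forall>x. mpoly_eval R (bits x) = mpoly_eval P (bits x) + c * mpoly_eval Q (bits x)"
        if "P \<in> V" "Q \<in> V" for P Q c
        using that unfolding V_def
        by (intro bexI[of _ "P + smult c Q"])
           (auto simp: mpoly_eval_add mpoly_eval_smult intro: mpolys_le_add mpolys_le_smult)
    qed
    then show ?thesis
      unfolding V_def by blast
  qed
  then obtain P R where P: "P \<in> mpolys_le n d" "\<And>x. x \<in> dom f \<Longrightarrow> mpoly_eval P (bits x) \<noteq> 0 \<longleftrightarrow> f x = Some True"
    and R: "R \<in> mpolys_le n d" "\<And>x. x \<in> dom f \<Longrightarrow> mpoly_eval R (bits x) \<noteq> 0 \<longleftrightarrow> f x = Some False"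
    by metis
  \<comment> \<open>At each point of the domain exactly one of \<open>P\<close> and \<open>R\<close>
    is nonzero, so the quotient is 1 or 0 as required.\<close>
  have "rationally_represents P (P + R) f"
    unfolding rationally_represents_def
  proof
    fix x assume x: "x \<in> dom f"
    then obtain b where "f x = Some b"
      by blast
    with P(2)[OF x] R(2)[OF x]
    show "mpoly_eval (P + R) (bits x) \<noteq> 0 \<and>
      mpoly_eval P (bits x) / mpoly_eval (P + R) (bits x) = of_bool (the (f x))"
      by (cases b) (auto simp: mpoly_eval_add)
  qed
  with P(1) R(1) show ?thesis
    using mpolys_le_add by blast
qed

lemma isolating_if_rationally_represents:
  assumes "P \<in> mpolys_le n d" "Q \<in> mpolys_le n d" "rationally_represents P Q f" "z \<in> dom f"
  shows "has_isolating_mpoly n d f z"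
proof -
  have nz: "mpoly_eval Q (bits x) \<noteq> 0" if "x \<in> dom f" for x
    using assms(3) that by (auto simp: rationally_represents_def)
  have P: "mpoly_eval P (bits x) = of_bool (f x = Some True) * mpoly_eval Q (bits x)"
    if "x \<in> dom f" for x
  proof -
    have "mpoly_eval P (bits x) / mpoly_eval Q (bits x) = of_bool (the (f x))"
      using assms(3) that by (auto simp: rationally_represents_def)
    with nz[OF that] that show ?thesis
      by (auto simp: field_simps)
  qed
  obtain b where b: "f z = Some b"
    using assms(4) by blast
  \<comment> \<open>On the domain \<open>P\<close> equals \<open>f * Q\<close> and
    \<open>Q - P\<close> equals \<open>(1 - f) * Q\<close>; each vanishes exactly on one fibre of
    \<open>f\<close>.\<close>
  let ?R = "if b then P else Q + smult (- 1) P"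
  have R: "mpoly_eval ?R (bits x) = of_bool (f x = f z) * mpoly_eval Q (bits x)" if "x \<in> dom f" for x
    using that b by (auto simp: P mpoly_eval_add mpoly_eval_smult)
  have "?R \<in> mpolys_le n d"
    using assms by (simp add: mpolys_le_add mpolys_le_smult)
  then show ?thesis
    unfolding has_isolating_mpoly_def
    using R nz assms(4) by (intro bexI[of _ ?R]) auto
qed

section \<open>Comparison of the two rational degrees\<close>

lemma rdeg_le_iff_represents:
  assumes "dom f \<subseteq> cube n"
  shows "rdeg n f \<le> d \<longleftrightarrow>
    (\<exists>P\<in>mpolys_le n d. \<exists>Q\<in>mpolys_le n d. rationally_represents P Q f)" (is "_ \<longleftrightarrow> ?R d")
proof -
  let ?E = "\<lambda>e. \<exists>P\<in>mpolys n. \<exists>Q\<in>mpolys n.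
    rationally_represents P Q f \<and> e = max (mpoly_degree P) (mpoly_degree Q)"
  have R_iff: "?R d \<longleftrightarrow> (\<exists>e\<le>d. ?E e)" for d
  proof -
    have "?R d \<longleftrightarrow> (\<exists>P\<in>mpolys n. \<exists>Q\<in>mpolys n.
      rationally_represents P Q f \<and> max (mpoly_degree P) (mpoly_degree Q) \<le> d)"
      unfolding mpolys_le_def max.bounded_iff by blast
    then show ?thesis
      by blast
  qed
  have "finite (dom f)"
    using assms finite_cube by (rule finite_subset)
  \<comment> \<open>Point indicators have degree at most \<open>n\<close>, so some representation
    exists and the \<open>LEAST\<close> in \<open>rdeg\<close> is attained.\<close>
  then have "?R n"
    using has_isolating_mpoly_n[OF assms] by (rule rationally_represents_if_isolating)
  then obtain e where "?E e"
    using R_iff by blast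
  then have "?E (rdeg n f)"
    unfolding rdeg_def by (rule LeastI)
  moreover have "rdeg n f \<le> e" if "?E e" for e
    unfolding rdeg_def using that by (rule Least_le)
  ultimately show ?thesis
    unfolding R_iff by (meson order_trans)
qed

lemma rdeg_le_iff:
  assumes "dom f \<subseteq> cube n"
  shows "rdeg n f \<le> d \<longleftrightarrow> (\<forall>z\<in>dom f. has_isolating_mpoly n d f z)"
proof -
  have "finite (dom f)"
    using assms finite_cube by (rule finite_subset)
  then show ?thesis
    unfolding rdeg_le_iff_represents[OF assms]
    using rationally_represents_if_isolating isolating_if_rationally_represents by blast
qed

lemma rdeg_f_cert_le_iff:
  assumes "dom f \<subseteq> cube n" "z \<in> dom f"
  shows "rdeg n (f_cert f z) \<le> d \<longleftrightarrow> has_isolating_mpoly n d f z"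
proof -
  have dom: "dom (f_cert f z) \<subseteq> cube n"
    using assms by (auto simp: dom_f_cert)
  have iff: "has_isolating_mpoly n d (f_cert f z) z \<longleftrightarrow> has_isolating_mpoly n d f z"
    unfolding has_isolating_mpoly_def dom_f_cert
    by (intro bex_cong) (auto simp: f_cert_def)
  show ?thesis
  proof
    assume "rdeg n (f_cert f z) \<le> d"
    then show "has_isolating_mpoly n d f z"
      unfolding rdeg_le_iff[OF dom] using iff by (auto simp: dom_f_cert)
  next
    assume "has_isolating_mpoly n d f z"
    then obtain P where P: "P \<in> mpolys_le n d" "mpoly_eval P (bits z) \<noteq> 0"
      "\<forall>y\<in>dom f. f y \<noteq> f z \<longrightarrow> mpoly_eval P (bits y) = 0"
      unfolding has_isolating_mpoly_def by blast
    \<comment> \<open>The constant polynomial with value \<open>P(z)\<close>: dividing by it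
      normalises \<open>P\<close> to 1 at \<open>z\<close>, and \<open>P\<close> already vanishes at
      every other point of the domain of \<open>f_cert f z\<close>.\<close>
    define Q where "Q = Poly_Mapping.single (0 :: nat \<Rightarrow>\<^sub>0 nat) (mpoly_eval P (bits z))"
    have "Q \<in> mpolys_le n d"
      by (simp add: Q_def mpolys_le_iff monom_degree_def)
    moreover have "rationally_represents P Q (f_cert f z)"
      unfolding rationally_represents_def
    proof
      fix x assume "x \<in> dom (f_cert f z)"
      then consider "x = z" | "x \<noteq> z" "x \<in> dom f" "f x \<noteq> f z"
        unfolding dom_f_cert by blast
      then show "mpoly_eval Q (bits x) \<noteq> 0 \<and>
        mpoly_eval P (bits x) / mpoly_eval Q (bits x) = of_bool (the (f_cert f z x))"
        by cases (use P(2,3) in \<open>simp_all add: f_cert_def Q_def mpoly_eval_single\<close>)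
    qed
    ultimately show "rdeg n (f_cert f z) \<le> d"
      unfolding rdeg_le_iff_represents[OF dom] using P(1) by blast
  qed
qed

lemma cert_rdeg:
  assumes "dom f \<subseteq> cube n" and "dom f \<noteq> {}"
  shows "cert_measure (rdeg n) f = rdeg n f"
proof -
  have "finite (dom f)"
    using assms(1) finite_cube by (rule finite_subset)
  \<comment> \<open>Both sides say that every point of the domain has an isolating polynomial of
    degree at most \<open>d\<close>; two numbers with the same upper bounds are equal.\<close>
  then have "cert_measure (rdeg n) f \<le> d \<longleftrightarrow> rdeg n f \<le> d" for d
    using assms(2) rdeg_f_cert_le_iff[OF assms(1)]
    by (simp add: cert_measure_def rdeg_le_iff[OF assms(1)])
  then show ?thesis
    by (meson order.antisym order.refl)
qed

theorem theorem11:
  fixes n :: nat and f :: "bool list \<rightharpoonup> bool"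
  assumes "dom f \<subseteq> cube n" and "dom f \<noteq> {}"
  shows "cert_measure (spectral_sensitivity n) f = sqrt (real (sensitivity n f))
           \<and> sqrt (real (sensitivity n f)) \<ge> sqrt (spectral_sensitivity n f)
         \<and> cert_measure (rdeg n) f = rdeg n f"
  using cert_spectral_sensitivity[OF assms] spectral_sensitivity_le_sensitivity[OF assms(1)]
    cert_rdeg[OF assms]
  by simp

end
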